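(* Let $m\ge 0$ be an integer, $k\in\mathbb{N}$ with $k\ge 1$, $\lambda,\xi\in\mathbb{C}\setminus\{0\}$, and $x\in\mathbb{C}$. Then $$\lambda^m B_m^{(k)}\left(\frac{x}{\lambda}\right) = \sum_{n=0}^m D_{n,\xi}^{(k)}(x|\lambda)\, \xi^{-n}\, s_2(m,n).$$
   Context: All identities are of formal power series in $t$, with $(1+\xi t)^a=\sum_{j\ge0}\binom{a}{j}\xi^j t^j$. The twisted $\lambda$-Daehee polynomials of the first kind of order $k$ are defined by $$\left(\frac{\lambda\log(1+\xi t)}{(1+\xi t)^\lambda-1}\right)^k(1+\xi t)^x = \sum_{n=0}^\infty D_{n,\xi}^{(k)}(x|\lambda)\frac{t^n}{n!}.$$ The Bernoulli polynomials of order $k$ are defined by $$\left(\frac{t}{e^t-1}\right)^k e^{xt} = \sum_{n=0}^\infty B_n^{(k)}(x)\frac{t^n}{n!}.$$ The Stirling numbers of the second kind $s_2(l,m)$ are given by $(e^t-1)^m = m!\sum_{l=m}^\infty s_2(l,m)\frac{t^l}{l!}$, with $s_2(l,m)=0$ for $m>l$. *)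

theory Defs
  imports
    Complex_Main
    "HOL-Computational_Algebra.Formal_Power_Series"
    "HOL-Combinatorics.Stirling"
begin

text \<open>The series of \<open>(1 + \<xi> t)\<^sup>a\<close> and of \<open>log (1 + \<xi> t)\<close>. Substituting the linear series
  \<open>\<xi> t\<close> for \<open>t\<close> multiplies the \<open>j\<close>-th coefficient by \<open>\<xi> ^ j\<close>.\<close>

definition twisted_binomial :: "complex \<Rightarrow> complex \<Rightarrow> complex fps" where
  "twisted_binomial \<xi> a = fps_binomial a oo (fps_const \<xi> * fps_X)"

definition twisted_log :: "complex \<Rightarrow> complex fps" where
  "twisted_log \<xi> = fps_ln 1 oo (fps_const \<xi> * fps_X)"

lemma twisted_binomial_nth: "fps_nth (twisted_binomial \<xi> a) j = (a gchoose j) * \<xi> ^ j"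
  by (simp add: twisted_binomial_def)

lemma twisted_log_nth:
  "fps_nth (twisted_log \<xi>) j = (if j = 0 then 0 else (- 1) ^ (j - 1) / of_nat j * \<xi> ^ j)"
  by (simp add: twisted_log_def fps_ln_nth)

text \<open>In both definitions below the denominator has no constant term, so it is not invertible as
  a power series; the quotient is nevertheless the exact one (as the lemmas show), for the Daehee
  polynomials provided that \<open>lam\<close> and \<open>\<xi>\<close> are nonzero.\<close>

definition twisted_daehee :: "nat \<Rightarrow> complex \<Rightarrow> complex \<Rightarrow> nat \<Rightarrow> complex \<Rightarrow> complex" where
  "twisted_daehee k \<xi> lam n x = fact n *
     fps_nth ((fps_const lam * twisted_log \<xi> / (twisted_binomial \<xi> lam - 1)) ^ k
       * twisted_binomial \<xi> x) n"

definition bernoulli_order :: "nat \<Rightarrow> nat \<Rightarrow> complex \<Rightarrow> complex" where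
  "bernoulli_order k n x = fact n * fps_nth ((fps_X / (fps_exp 1 - 1)) ^ k * fps_exp x) n"

lemma twisted_daehee_quotient_exact:
  assumes "\<xi> \<noteq> 0" "lam \<noteq> 0"
  shows "fps_const lam * twisted_log \<xi> / (twisted_binomial \<xi> lam - 1)
           * (twisted_binomial \<xi> lam - 1) = fps_const lam * twisted_log \<xi>"
proof -
  have s: "subdegree (twisted_binomial \<xi> lam - 1) = 1"
    using assms by (intro subdegreeI) (auto simp: twisted_binomial_nth)
  have s': "subdegree (fps_const lam * twisted_log \<xi>) = 1"
    using assms by (intro subdegreeI) (auto simp: twisted_log_nth)
  have "twisted_binomial \<xi> lam - 1 \<noteq> 0" "fps_const lam * twisted_log \<xi> \<noteq> 0"
    using s s' by (metis subdegree_0 zero_neq_one)+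
  then have "(twisted_binomial \<xi> lam - 1) dvd (fps_const lam * twisted_log \<xi>)"
    using s s' by (simp add: fps_dvd_iff)
  then show ?thesis by simp
qed

lemma bernoulli_quotient_exact: "fps_X / (fps_exp 1 - 1) * (fps_exp 1 - 1 :: complex fps) = fps_X"
proof -
  have s: "subdegree (fps_exp 1 - 1 :: complex fps) = 1"
    by (intro subdegreeI) auto
  have "(fps_exp 1 - 1 :: complex fps) \<noteq> 0"
    using s by (metis subdegree_0 zero_neq_one)
  then have "(fps_exp 1 - 1 :: complex fps) dvd fps_X"
    using s by (simp add: fps_dvd_iff)
  then show ?thesis by simp
qed

text \<open>The library's \<^const>\<open>Stirling\<close>, introduced there by its recurrence, is characterised by
  the exponential generating function \<open>(e\<^sup>t - 1)\<^sup>m = m! \<Sum>\<^sub>l s\<^sub>2(l, m) t\<^sup>l / l!\<close>.\<close>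

lemma Stirling_generating_function:
  "(fps_exp 1 - 1 :: complex fps) ^ m =
     fps_const (fact m) * Abs_fps (\<lambda>l. of_nat (Stirling l m) / fact l)"
proof -
  have "fact l * fps_nth ((fps_exp 1 - 1 :: complex fps) ^ m) l = fact m * of_nat (Stirling l m)"
    for l
  proof (induction l arbitrary: m)
    case 0
    then show ?case by (cases m) (auto simp: fps_power_zeroth)
  next
    case (Suc l)
    show ?case
    proof (cases m)
      case 0
      then show ?thesis by simp
    next
      case (Suc j)
      have "fps_deriv ((fps_exp 1 - 1 :: complex fps) ^ m) =
              of_nat m * (fps_exp 1 - 1) ^ m + of_nat m * (fps_exp 1 - 1) ^ j"
      proof -
        have "fps_deriv ((fps_exp 1 - 1 :: complex fps) ^ m) =
                of_nat m * ((fps_exp 1 - 1) + 1) * (fps_exp 1 - 1) ^ j"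
          by (simp add: fps_deriv_power' Suc del: of_nat_Suc power_Suc)
        also have "of_nat m * (e + 1) * e ^ j = of_nat m * e ^ m + of_nat m * e ^ j"
          for e :: "complex fps"
          by (simp add: Suc algebra_simps del: of_nat_Suc)
        finally show ?thesis .
      qed
      from arg_cong[OF this, of "\<lambda>f. fps_nth f l"]
      have "of_nat (Suc l) * fps_nth ((fps_exp 1 - 1 :: complex fps) ^ m) (Suc l) =
              of_nat m * fps_nth ((fps_exp 1 - 1) ^ m) l
              + of_nat m * fps_nth ((fps_exp 1 - 1) ^ j) l"
        by (simp add: fps_of_nat[symmetric] del: of_nat_Suc)
      then have "fact (Suc l) * fps_nth ((fps_exp 1 - 1 :: complex fps) ^ m) (Suc l) =
              of_nat m * (fact l * fps_nth ((fps_exp 1 - 1) ^ m) l)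
              + of_nat m * (fact l * fps_nth ((fps_exp 1 - 1) ^ j) l)"
        by (simp add: algebra_simps del: of_nat_Suc)
      also have "\<dots> = fact m * of_nat (Stirling (Suc l) m)"
        unfolding Suc.IH by (simp add: \<open>m = Suc j\<close> algebra_simps)
      finally show ?thesis .
    qed
  qed
  then show ?thesis
    by (intro fps_ext) (simp add: field_simps)
qed

end

theory Submission
  imports Defs
begin

text \<open>Substitute \<open>(e\<^sup>t - 1) / \<xi>\<close> for \<open>t\<close> in the generating function of the Daehee polynomials. Since
  \<open>1 + \<xi> t\<close> becomes \<open>e\<^sup>t\<close>, the result is \<open>(\<lambda> t / (e\<^bsup>\<lambda> t\<^esup> - 1))\<^sup>k e\<^bsup>x t\<^esup>\<close>, the generating function of the
  Bernoulli polynomials of order \<open>k\<close> at \<open>x / \<lambda>\<close> with \<open>\<lambda> t\<close> substituted for \<open>t\<close>. On the Daehee side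
  the powers of \<open>(e\<^sup>t - 1) / \<xi>\<close> expand into Stirling numbers; compare coefficients.\<close>

text \<open>The binomial series solves \<open>(1 + t) y' = a y\<close>. Under the substitution
  \<open>1 + t\<close> becomes \<open>e^t\<close>, which is also the derivative of
  \<open>e^t - 1\<close>, so by the chain rule the composite solves \<open>y' = a y\<close> with
  constant term 1.\<close>

lemma fps_binomial_compose_exp:
  fixes a :: "'a::field_char_0"
  shows "fps_binomial a oo (fps_exp 1 - 1) = fps_exp a"
proof -
  let ?e = "fps_exp (1::'a) - 1"
  let ?f = "fps_binomial a oo ?e"
  have e0: "fps_nth ?e 0 = 0"
    by simp
  have "(1 + fps_X) * fps_deriv (fps_binomial a) = fps_const a * fps_binomial a"
    by (simp add: fps_binomial_deriv fps_divide_unit mult.commute[of "1 + fps_X"] mult.assoc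
        inverse_mult_eq_1)
  then have "((1 + fps_X) * fps_deriv (fps_binomial a)) oo ?e = (fps_const a * fps_binomial a) oo ?e"
    by simp
  then have "fps_exp 1 * (fps_deriv (fps_binomial a) oo ?e) = fps_const a * ?f"
    by (simp add: fps_compose_mult_distrib[OF e0] fps_compose_add_distrib
        fps_X_fps_compose_startby0[OF e0])
  then have "fps_deriv ?f = fps_const a * ?f"
    by (simp add: fps_compose_deriv[OF e0] mult.commute)
  then have "?f = fps_const (fps_nth ?f 0) * fps_exp a"
    by (simp only: fps_exp_unique_ODE)
  then show ?thesis
    by simp
qed

lemma fps_ln_compose_exp: "fps_ln 1 oo (fps_exp 1 - 1) = (fps_X :: 'a::field_char_0 fps)"
  by (simp add: fps_ln_fps_exp_inv fps_inv)

text \<open>Cancels the scaling by \<xi> built into the twisted series; \<open>h\<close> has no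
  constant term, so composition is associative here.\<close>

lemma fps_compose_scaled_var:
  assumes "(c::'a::field) \<noteq> 0" "fps_nth h 0 = 0"
  shows "(f oo (fps_const c * fps_X)) oo (fps_const (inverse c) * h) = f oo h"
proof -
  have g0: "fps_nth (fps_const (inverse c) * h) 0 = 0"
    using assms by simp
  have "(fps_const c * fps_X) oo (fps_const (inverse c) * h) = h"
    using assms by (simp add: fps_compose_mult_distrib[OF g0] fps_X_fps_compose_startby0[OF g0]
        mult.assoc[symmetric])
  then show ?thesis
    using fps_compose_assoc[OF g0, of "fps_const c * fps_X" f] by simp
qed

text \<open>The Stirling generating function gives the coefficient of \<open>t^m\<close> in each
  power \<open>(e^t - 1)^n\<close>.\<close>

lemma fps_compose_exp_minus_1_nth:
  fixes F :: "complex fps"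
  shows "fact m * fps_nth (F oo (fps_const c * (fps_exp 1 - 1))) m =
    (\<Sum>n=0..m. fact n * fps_nth F n * c ^ n * of_nat (Stirling m n))"
  by (simp add: fps_compose_nth power_mult_distrib Stirling_generating_function
      sum_distrib_left mult_ac)

lemma daehee_gf_compose:
  fixes lam \<xi> x :: complex
  assumes "lam \<noteq> 0" "\<xi> \<noteq> 0"
  shows "((fps_const lam * twisted_log \<xi> / (twisted_binomial \<xi> lam - 1)) ^ k * twisted_binomial \<xi> x)
      oo (fps_const (inverse \<xi>) * (fps_exp 1 - 1)) =
    ((fps_X / (fps_exp 1 - 1)) ^ k * fps_exp (x / lam)) oo (fps_const lam * fps_X)"
proof -
  define Q where "Q = fps_const lam * twisted_log \<xi> / (twisted_binomial \<xi> lam - 1)"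
  define P where "P = (fps_X / (fps_exp 1 - 1) :: complex fps)"
  define g where "g = fps_const (inverse \<xi>) * (fps_exp 1 - 1 :: complex fps)"
  define s where "s = fps_const lam * fps_X"
  have g0: "fps_nth g 0 = 0" and s0: "fps_nth s 0 = 0"
    by (simp_all add: g_def s_def)
  have bin: "twisted_binomial \<xi> a oo g = fps_exp a" for a
    using assms by (simp add: twisted_binomial_def g_def fps_compose_scaled_var
        fps_binomial_compose_exp)
  have log: "twisted_log \<xi> oo g = fps_X"
    using assms by (simp add: twisted_log_def g_def fps_compose_scaled_var fps_ln_compose_exp)
  have exp: "fps_exp a oo s = fps_exp (a * lam)" for a
    by (rule fps_ext) (simp add: s_def power_mult_distrib)
  \<comment> \<open>The quotients are compared in multiplied-out form, since composition distributes
    over products: \<open>Q oo g\<close> and \<open>P oo s\<close> both yield \<open>s\<close> when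
    multiplied by \<open>fps_exp lam - 1\<close>, which is then cancelled.\<close>
  have "(Q * (twisted_binomial \<xi> lam - 1)) oo g = (fps_const lam * twisted_log \<xi>) oo g"
    using twisted_daehee_quotient_exact[OF assms(2,1)] by (simp add: Q_def)
  then have Q: "(Q oo g) * (fps_exp lam - 1) = s"
    by (simp add: fps_compose_mult_distrib[OF g0] fps_compose_sub_distrib bin log s_def)
  have "(P * (fps_exp 1 - 1)) oo s = fps_X oo s"
    using bernoulli_quotient_exact by (simp add: P_def)
  then have P: "(P oo s) * (fps_exp lam - 1) = s"
    by (simp add: fps_compose_mult_distrib[OF s0] fps_compose_sub_distrib exp
        fps_X_fps_compose_startby0[OF s0])
  have "s \<noteq> 0"
    using assms by (simp add: s_def)
  then have "fps_exp lam - 1 \<noteq> 0"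
    using P by auto
  then have "Q oo g = P oo s"
    using P Q by (metis mult_right_cancel)
  then have "(Q ^ k * twisted_binomial \<xi> x) oo g = (P ^ k * fps_exp (x / lam)) oo s"
    using assms by (simp add: fps_compose_mult_distrib[OF g0] fps_compose_mult_distrib[OF s0]
        fps_compose_power[OF g0, symmetric] fps_compose_power[OF s0, symmetric] bin exp)
  then show ?thesis
    by (simp add: Q_def P_def g_def s_def)
qed

theorem theorem4p3:
  fixes m k :: nat and lam \<xi> x :: complex
  assumes "k \<ge> 1" and "lam \<noteq> 0" and "\<xi> \<noteq> 0"
  shows "lam ^ m * bernoulli_order k m (x / lam) =
    (\<Sum>n=0..m. twisted_daehee k \<xi> lam n x * \<xi> powi (- int n) * of_nat (Stirling m n))"
proof -
  let ?P = "(fps_X / (fps_exp 1 - 1)) ^ k * fps_exp (x / lam)"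
  \<comment> \<open>Substituting \<open>lam * t\<close> for \<open>t\<close> multiplies the
    coefficient of \<open>t^m\<close> by \<open>lam ^ m\<close>.\<close>
  have "lam ^ m * bernoulli_order k m (x / lam) = fact m * fps_nth (?P oo (fps_const lam * fps_X)) m"
    by (simp add: bernoulli_order_def)
  also have "\<dots> = (\<Sum>n=0..m. twisted_daehee k \<xi> lam n x * inverse \<xi> ^ n * of_nat (Stirling m n))"
    unfolding daehee_gf_compose[OF assms(2,3), symmetric] fps_compose_exp_minus_1_nth
    by (simp add: twisted_daehee_def)
  finally show ?thesis
    by (simp add: power_int_minus power_inverse)
qed

end
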